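(* Let $u,v\in S_n$. The minimal weight of a shortest directed path from $u$ to $v$ in the quantum Bruhat graph $\Gamma_n$ equals \[q_1^{d_1(u,v)}q_2^{d_2(u,v)}\cdots q_{n-1}^{d_{n-1}(u,v)},\qquad\text{where } d_k(u,v):=\operatorname{depth}(u[k],v[k])\ \text{ for } k\in[n-1].\]
   Context: Permutations $w\in S_n$ are written in one-line notation $w=w_1w_2\cdots w_n$, and $w[k]:=\{w_1,\dots,w_k\}$. For $i<j$, $t_{ij}$ is the transposition $(i\ j)$, and $wt_{ij}$ is the permutation obtained from $w$ by swapping the entries in positions $i$ and $j$; $\ell(w)$ is the number of inversions of $w$. The quantum Bruhat graph $\Gamma_n$ is the directed weighted graph on $S_n$ with an edge $w\to wt_{ij}$ ($1\le i<j\le n$) of weight $1$ if $\ell(wt_{ij})=\ell(w)+1$, and of weight $q_{ij}:=q_iq_{i+1}\cdots q_{j-1}$ if $\ell(wt_{ij})=\ell(w)+1-2(j-i)$; there are no other edges. The weight of a directed path is the product of the weights of its edges. For $A,B\subseteq[n]$ with $|A|=|B|$, the lattice path $\Lambda(A,B)$ starts at $(1,0)$ and takes $n$ steps, the $i$-th step being $(1,1)$ if $i\in A\setminus B$, $(1,-1)$ if $i\in B\setminus A$, and $(1,0)$ otherwise (ending at $(n+1,0)$). $\operatorname{depth}(A,B)$ is the largest $y\ge 0$ such that $\Lambda(A,B)$ passes through a point $(x,-y)$. *)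

theory Defs
  imports
    "HOL-Combinatorics.Permutations"
    "HOL-Library.Poly_Mapping"
    "HOL-Library.Product_Plus"
    "Graph_Theory.Arc_Walk"
begin

text \<open>
  An element of \<open>S\<^sub>n\<close> is a function \<open>w\<close> with \<open>w permutes {1..n}\<close>; its one-line notation is
  \<open>w 1, ..., w n\<close>.  Swapping the entries in positions \<open>i\<close> and \<open>j\<close> is right multiplication by
  a transposition, i.e. \<open>w \<circ> transpose i j\<close>.
\<close>

definition prefix_set :: "(nat \<Rightarrow> nat) \<Rightarrow> nat \<Rightarrow> nat set" where
  "prefix_set w k = w ` {1..k}"

definition inversions :: "nat \<Rightarrow> (nat \<Rightarrow> nat) \<Rightarrow> (nat \<times> nat) set" where
  "inversions n w = {(i, j). 1 \<le> i \<and> i < j \<and> j \<le> n \<and> w j < w i}"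

definition perm_length :: "nat \<Rightarrow> (nat \<Rightarrow> nat) \<Rightarrow> nat" where
  "perm_length n w = card (inversions n w)"

text \<open>Weights live in the polynomial ring over the integers in variables indexed by \<open>nat\<close>.\<close>

type_synonym qpoly = "(nat \<Rightarrow>\<^sub>0 nat) \<Rightarrow>\<^sub>0 int"

definition qvar :: "nat \<Rightarrow> qpoly" where
  "qvar i = Poly_Mapping.single (Poly_Mapping.single i 1) 1"

text \<open>
  The triple \<open>(w, i, j)\<close> stands for the edge from \<open>w\<close> to \<open>w \<circ> transpose i j\<close>.  There are no parallel
  edges, since \<open>w\<close> and \<open>w \<circ> transpose i j\<close> determine \<open>i < j\<close>.
\<close>

type_synonym qedge = "(nat \<Rightarrow> nat) \<times> nat \<times> nat"

definition is_up_edge :: "nat \<Rightarrow> qedge \<Rightarrow> bool" where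
  "is_up_edge n = (\<lambda>(w, i, j).
     perm_length n (w \<circ> transpose i j) = perm_length n w + 1)"

definition is_down_edge :: "nat \<Rightarrow> qedge \<Rightarrow> bool" where
  "is_down_edge n = (\<lambda>(w, i, j).
     int (perm_length n (w \<circ> transpose i j)) = int (perm_length n w) + 1 - 2 * (int j - int i))"

definition quantum_bruhat_graph :: "nat \<Rightarrow> (nat \<Rightarrow> nat, qedge) pre_digraph" where
  "quantum_bruhat_graph n =
     \<lparr> verts = {w. w permutes {1..n}},
       arcs = {(w, i, j). w permutes {1..n} \<and> 1 \<le> i \<and> i < j \<and> j \<le> n \<and>
                 (is_up_edge n (w, i, j) \<or> is_down_edge n (w, i, j))},
       tail = (\<lambda>(w, i, j). w),
       head = (\<lambda>(w, i, j). w \<circ> transpose i j) \<rparr>"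

text \<open>The two kinds of edges are disjoint for \<open>i < j\<close>, so the order of the case distinction is immaterial.\<close>

definition edge_weight :: "nat \<Rightarrow> qedge \<Rightarrow> qpoly" where
  "edge_weight n e =
     (if is_up_edge n e then 1 else (case e of (w, i, j) \<Rightarrow> \<Prod>k\<in>{i..<j}. qvar k))"

definition path_weight :: "nat \<Rightarrow> qedge list \<Rightarrow> qpoly" where
  "path_weight n p = prod_list (map (edge_weight n) p)"

definition shortest_path :: "nat \<Rightarrow> (nat \<Rightarrow> nat) \<Rightarrow> qedge list \<Rightarrow> (nat \<Rightarrow> nat) \<Rightarrow> bool" where
  "shortest_path n u p v \<longleftrightarrow>
     is_arg_min length (\<lambda>p. pre_digraph.apath (quantum_bruhat_graph n) u p v) p"

text \<open>
  Weights are compared by divisibility; in particular this predicate asserts that some shortest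
  path exists and has weight \<open>m\<close>.
\<close>

definition is_min_shortest_weight :: "nat \<Rightarrow> (nat \<Rightarrow> nat) \<Rightarrow> (nat \<Rightarrow> nat) \<Rightarrow> qpoly \<Rightarrow> bool" where
  "is_min_shortest_weight n u v m \<longleftrightarrow>
     m \<in> {path_weight n p | p. shortest_path n u p v} \<and>
     (\<forall>p. shortest_path n u p v \<longrightarrow> m dvd path_weight n p)"

definition lattice_step :: "nat set \<Rightarrow> nat set \<Rightarrow> nat \<Rightarrow> int \<times> int" where
  "lattice_step A B i =
     (if i \<in> A - B then (1, 1) else if i \<in> B - A then (1, -1) else (1, 0))"

primrec lattice_point :: "nat set \<Rightarrow> nat set \<Rightarrow> nat \<Rightarrow> int \<times> int" where
  "lattice_point A B 0 = (1, 0)"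
| "lattice_point A B (Suc i) = lattice_point A B i + lattice_step A B (Suc i)"

definition lattice_path :: "nat \<Rightarrow> nat set \<Rightarrow> nat set \<Rightarrow> (int \<times> int) set" where
  "lattice_path n A B = lattice_point A B ` {0..n}"

text \<open>
  The maximum is over a finite set that contains \<open>0\<close>, the path starting at \<open>(1, 0)\<close>.
\<close>

definition depth :: "nat \<Rightarrow> nat set \<Rightarrow> nat set \<Rightarrow> nat" where
  "depth n A B = Max {y. \<exists>x. (x, - int y) \<in> lattice_path n A B}"

definition depth_exponent :: "nat \<Rightarrow> (nat \<Rightarrow> nat) \<Rightarrow> (nat \<Rightarrow> nat) \<Rightarrow> nat \<Rightarrow> nat" where
  "depth_exponent n u v k = depth n (prefix_set u k) (prefix_set v k)"

end

theory Submission
  imports Defs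
begin

text \<open>
  Let \<open>r\<^sub>w(k, m)\<close> be the number of positions \<open>l \<le> k\<close> with \<open>w l \<le> m\<close>.  Then
  \<open>d\<^sub>k(u, v)\<close> is the maximum over \<open>m\<close> of \<open>r\<^sub>v(k, m) - r\<^sub>u(k, m)\<close>, so it satisfies the
  triangle inequality; since the weight of an edge dominates its depth, the weight of every walk is
  divisible by the claimed monomial.  The length of a walk is determined by its end points and the
  degree of its weight, so it remains to find one walk whose weight attains the bound.

  A greedy walk does.  Suppose \<open>u\<close> and \<open>v\<close> agree before position \<open>p\<close> but \<open>u p \<noteq> v p\<close>.
  Reading the values on a circle, swap \<open>u p\<close> with the first later entry \<open>u j\<close> in the cyclic
  interval from \<open>u p\<close> (excluded) to \<open>v p\<close> (included).  No entry strictly between positions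
  \<open>p\<close> and \<open>j\<close> lies in this interval; hence the swap is an edge, and
  \<open>r\<^sub>v(k, m) - r\<^sub>u(k, m)\<close> increases weakly along the interval as \<open>m\<close> approaches \<open>v p\<close>, and
  strictly at \<open>v p\<close>, which makes the depths along the edge add up exactly.
\<close>

section \<open>Depths expressed through rank functions\<close>

definition height_diff :: "nat set \<Rightarrow> nat set \<Rightarrow> nat \<Rightarrow> int" where
  "height_diff A B m = (\<Sum>i\<in>{1..m}. of_bool (i \<in> B) - of_bool (i \<in> A))"

lemma lattice_point_eq: "lattice_point A B m = (1 + int m, - height_diff A B m)"
  by (induction m) (auto simp: height_diff_def lattice_step_def)

text \<open>Turns every later depth estimate into a pointwise check in \<open>m\<close>, with no
  further use of \<open>Max\<close>. Negative values of \<open>height_diff\<close> are not of the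
  form \<open>int y\<close>, but they lie below \<open>int d\<close> anyway.\<close>

lemma depth_le_iff: "depth n A B \<le> d \<longleftrightarrow> (\<forall>m\<le>n. height_diff A B m \<le> int d)"
proof -
  let ?S = "{y. \<exists>x. (x, - int y) \<in> lattice_path n A B}"
  have S: "?S = {y. \<exists>m\<le>n. height_diff A B m = int y}"
    by (force simp: lattice_path_def lattice_point_eq)
  have "?S \<subseteq> (\<lambda>m. nat (height_diff A B m)) ` {..n}"
    unfolding S by (force simp: image_iff)
  then have fin: "finite ?S"
    by (rule finite_subset) simp
  have zero: "0 \<in> ?S"
    unfolding S by (auto simp: height_diff_def intro: exI[of _ 0])
  show ?thesis
    unfolding depth_def
  proof (subst Max_le_iff[OF fin], use zero in blast, safe)
    fix m assume le: "\<forall>y\<in>?S. y \<le> d" and m: "m \<le> n"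
    show "height_diff A B m \<le> int d"
    proof (cases "height_diff A B m \<ge> 0")
      case True
      then have "nat (height_diff A B m) \<in> ?S"
        unfolding S using m by auto
      with le have "nat (height_diff A B m) \<le> d" by blast
      then show ?thesis by simp
    qed simp
  next
    fix y x assume "\<forall>m\<le>n. height_diff A B m \<le> int d" "(x, - int y) \<in> lattice_path n A B"
    then show "y \<le> d" by (auto simp: lattice_path_def lattice_point_eq)
  qed
qed

definition rank :: "(nat \<Rightarrow> nat) \<Rightarrow> nat \<Rightarrow> nat \<Rightarrow> int" where
  "rank w k m = (\<Sum>l\<in>{1..k}. of_bool (w l \<le> m))"

text \<open>Injectivity matches the values at most \<open>m\<close> in the prefix with the positions
  holding them. The bound \<open>1 \<le> w l\<close> rules out the value 0, which
  \<open>rank\<close> would count and the left sum would miss.\<close>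

lemma sum_of_bool_image:
  assumes "inj_on w {1..k}" and "\<And>l. l \<in> {1..k} \<Longrightarrow> 1 \<le> w l"
  shows "(\<Sum>i\<in>{1..m}. of_bool (i \<in> w ` {1..k})) = rank w k m"
proof -
  have "(\<Sum>i\<in>{1..m}. of_bool (i \<in> w ` {1..k})) = int (card ({1..m} \<inter> w ` {1..k}))"
    by (simp add: sum_of_bool_eq flip: Int_def) 
  also have "{1..m} \<inter> w ` {1..k} = w ` {l\<in>{1..k}. w l \<le> m}"
    using assms(2) by auto
  also have "card \<dots> = card {l\<in>{1..k}. w l \<le> m}"
    by (rule card_image) (rule inj_on_subset[OF assms(1)], auto)
  also have "int \<dots> = rank w k m"
    by (simp add: rank_def sum_of_bool_eq Int_def)
  finally show ?thesis .
qed

lemma height_diff_prefix_sets: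
  assumes "u permutes {1..n}" "v permutes {1..n}" "k \<le> n"
  shows "height_diff (prefix_set u k) (prefix_set v k) m = rank v k m - rank u k m"
proof -
  have *: "(\<Sum>i\<in>{1..m}. of_bool (i \<in> w ` {1..k})) = rank w k m" if w: "w permutes {1..n}" for w
  proof (rule sum_of_bool_image)
    show "inj_on w {1..k}" using permutes_inj_on[OF w] .
    show "1 \<le> w l" if "l \<in> {1..k}" for l
      using permutes_in_image[OF w, of l] that assms(3) by auto
  qed
  show ?thesis
    unfolding height_diff_def prefix_set_def sum_subtractf using *[OF assms(1)] *[OF assms(2)] by simp
qed

lemma depth_exponent_le_iff:
  assumes "u permutes {1..n}" "v permutes {1..n}" "k \<le> n"
  shows "depth_exponent n u v k \<le> d \<longleftrightarrow> (\<forall>m\<le>n. rank v k m - rank u k m \<le> int d)"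
  by (simp add: depth_exponent_def depth_le_iff height_diff_prefix_sets[OF assms])

text \<open>For \<open>k < i\<close> or \<open>j \<le> k\<close> the set of the first
  \<open>k\<close> entries is unaffected; otherwise \<open>w j\<close> replaces \<open>w i\<close>
  in it.\<close>

lemma rank_transpose:
  assumes "1 \<le> i" "i < j"
  shows "rank (w \<circ> transpose i j) k m =
    rank w k m + (if i \<le> k \<and> k < j then of_bool (w j \<le> m) - of_bool (w i \<le> m) else 0)"
proof -
  consider "k < i" | "j \<le> k" | "i \<le> k" "k < j" by linarith
  then show ?thesis
  proof cases
    case 1
    then show ?thesis using assms by (auto simp: rank_def transpose_def intro!: sum.cong)
  next
    case 2
    then have "transpose i j permutes {1..k}"
      using assms by (auto intro: permutes_swap_id)
    from sum.permute[OF this, of "\<lambda>l. of_bool (w l \<le> m) :: int"] 2 assms show ?thesis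
      by (simp add: rank_def o_def del: sum_of_bool_eq)
  next
    case 3
    then have i: "i \<in> {1..k}" using assms by auto
    show ?thesis
      unfolding rank_def sum.remove[OF finite_atLeastAtMost i] using 3
      by (auto simp: transpose_def intro!: sum.cong)
  qed
qed

section \<open>Change of length under a swap of two entries\<close>

lemma perm_length_sum:
  "int (perm_length n w) = (\<Sum>a\<in>{1..n}. \<Sum>b\<in>{1..n}. of_bool (a < b \<and> w b < w a))"
proof -
  have "inversions n w = {p \<in> {1..n} \<times> {1..n}. case p of (a, b) \<Rightarrow> a < b \<and> w b < w a}"
    by (auto simp: inversions_def)
  then have "int (perm_length n w) =
      (\<Sum>p\<in>{1..n} \<times> {1..n}. of_bool (case p of (a, b) \<Rightarrow> a < b \<and> w b < w a))"
    by (simp add: perm_length_def sum_of_bool_eq Int_def)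
  also have "\<dots> = (\<Sum>a\<in>{1..n}. \<Sum>b\<in>{1..n}. of_bool (a < b \<and> w b < w a))"
    by (simp only: sum.cartesian_product case_prod_unfold fst_conv snd_conv)
  finally show ?thesis .
qed

text \<open>Isolates the rows and columns \<open>i\<close> and \<open>j\<close>, the only ones that
  a swap affects.\<close>

lemma sum_pairs_remove2:
  fixes f :: "'a \<Rightarrow> 'a \<Rightarrow> 'b::comm_monoid_add"
  assumes "finite S" "i \<notin> S" "j \<notin> S" "i \<noteq> j"
  shows "(\<Sum>a\<in>insert i (insert j S). \<Sum>b\<in>insert i (insert j S). f a b) =
    (\<Sum>a\<in>S. \<Sum>b\<in>S. f a b) + (\<Sum>l\<in>S. f i l + f l i + f j l + f l j) + (f i i + f i j + f j i + f j j)"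
  using assms by (simp add: sum.distrib ac_simps)

text \<open>The pair \<open>(i, j)\<close> becomes an inversion. A third position contributes two
  new inversions if it lies between \<open>i\<close> and \<open>j\<close> in both position and
  value; otherwise its total with \<open>i\<close> and \<open>j\<close> is unchanged.\<close>

lemma perm_length_transpose_ascent:
  assumes w: "w permutes {1..n}" and ij: "1 \<le> i" "i < j" "j \<le> n" and asc: "w i < w j"
  shows "perm_length n (w \<circ> transpose i j) =
    perm_length n w + 1 + 2 * card {l. i < l \<and> l < j \<and> w i < w l \<and> w l < w j}"
proof -
  define S where "S = {1..n} - {i, j}"
  define c :: "nat \<Rightarrow> int" where "c l = of_bool (i < l \<and> l < j \<and> w i < w l \<and> w l < w j)" for l
  define f :: "(nat \<Rightarrow> nat) \<Rightarrow> nat \<Rightarrow> nat \<Rightarrow> int" where "f x a b = of_bool (a < b \<and> x b < x a)" for x a b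
  let ?w = "w \<circ> transpose i j"
  have split: "{1..n} = insert i (insert j S)" and S: "finite S" "i \<notin> S" "j \<notin> S" "i \<noteq> j"
    using ij by (auto simp: S_def)
  have len: "int (perm_length n x) = (\<Sum>a\<in>S. \<Sum>b\<in>S. f x a b) +
      (\<Sum>l\<in>S. f x i l + f x l i + f x j l + f x l j) + (f x i i + f x i j + f x j i + f x j j)" for x
    unfolding perm_length_sum f_def[symmetric] split by (rule sum_pairs_remove2[OF S])
  have inj: "w a = w b \<longleftrightarrow> a = b" for a b
    using permutes_inj[OF w] by (simp add: inj_eq)
  have "f ?w i l + f ?w l i + f ?w j l + f ?w l j = f w i l + f w l i + f w j l + f w l j + 2 * c l"
    if "l \<in> S" for l
  proof -
    have "l \<noteq> i" "l \<noteq> j" "w l \<noteq> w i" "w l \<noteq> w j" using that by (auto simp: S_def inj)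
    then show ?thesis using ij(2) asc
      by (cases "l < i"; cases "l < j"; cases "w l < w i"; cases "w l < w j") (simp_all add: f_def c_def)
  qed
  then have "(\<Sum>l\<in>S. f ?w i l + f ?w l i + f ?w j l + f ?w l j) =
      (\<Sum>l\<in>S. f w i l + f w l i + f w j l + f w l j) + 2 * (\<Sum>l\<in>S. c l)"
    by (simp add: sum.distrib sum_distrib_left)
  moreover have "(\<Sum>a\<in>S. \<Sum>b\<in>S. f ?w a b) = (\<Sum>a\<in>S. \<Sum>b\<in>S. f w a b)"
    by (intro sum.cong refl) (auto simp: f_def S_def transpose_def)
  moreover have "f ?w i i + f ?w i j + f ?w j i + f ?w j j = f w i i + f w i j + f w j i + f w j j + 1"
    using ij(2) asc by (simp add: f_def)
  moreover have "(\<Sum>l\<in>S. c l) = int (card {l. i < l \<and> l < j \<and> w i < w l \<and> w l < w j})"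
  proof -
    have "{l \<in> S. i < l \<and> l < j \<and> w i < w l \<and> w l < w j} = {l. i < l \<and> l < j \<and> w i < w l \<and> w l < w j}"
      using ij by (auto simp: S_def)
    then show ?thesis by (simp add: c_def sum_of_bool_eq S Int_def)
  qed
  ultimately show ?thesis using len[of w] len[of ?w] by linarith
qed

text \<open>The swapped permutation has an ascent at \<open>i, j\<close>, and swapping again returns
  \<open>w\<close>.\<close>

lemma perm_length_transpose_descent:
  assumes w: "w permutes {1..n}" and ij: "1 \<le> i" "i < j" "j \<le> n" and desc: "w j < w i"
  shows "perm_length n w = perm_length n (w \<circ> transpose i j) + 1 +
    2 * card {l. i < l \<and> l < j \<and> w j < w l \<and> w l < w i}"
proof -
  let ?w = "w \<circ> transpose i j"
  have "?w permutes {1..n}"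
    using ij by (intro permutes_compose[OF _ w] permutes_swap_id) auto
  from perm_length_transpose_ascent[OF this ij] desc
  have "perm_length n w = perm_length n ?w + 1 + 2 * card {l. i < l \<and> l < j \<and> ?w i < ?w l \<and> ?w l < ?w j}"
    by (simp add: comp_assoc)
  also have "{l. i < l \<and> l < j \<and> ?w i < ?w l \<and> ?w l < ?w j} = {l. i < l \<and> l < j \<and> w j < w l \<and> w l < w i}"
    by (auto simp: transpose_def)
  finally show ?thesis .
qed


lemma transpose_ascent_if_up_edge:
  assumes w: "w permutes {1..n}" and ij: "1 \<le> i" "i < j" "j \<le> n" and up: "is_up_edge n (w, i, j)"
  shows "w i < w j"
proof (rule ccontr)
  assume "\<not> w i < w j"
  moreover have "w i \<noteq> w j"
    using permutes_inj[OF w] ij(2) by (auto dest: injD)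
  ultimately have "w j < w i" by linarith
  from perm_length_transpose_descent[OF w ij this] up show False
    by (simp add: is_up_edge_def)
qed

section \<open>Exponents of walks and their lower bound by depths\<close>

lemma quantum_bruhat_graph_simps [simp]:
  "verts (quantum_bruhat_graph n) = {w. w permutes {1..n}}"
  "(w, i, j) \<in> arcs (quantum_bruhat_graph n) \<longleftrightarrow> w permutes {1..n} \<and> 1 \<le> i \<and> i < j \<and> j \<le> n \<and>
     (is_up_edge n (w, i, j) \<or> is_down_edge n (w, i, j))"
  "tail (quantum_bruhat_graph n) (w, i, j) = w"
  "head (quantum_bruhat_graph n) (w, i, j) = w \<circ> transpose i j"
  by (auto simp: quantum_bruhat_graph_def)

lemma permutes_comp_transpose:
  assumes "w permutes S" "i \<in> S" "j \<in> S"
  shows "w \<circ> transpose i j permutes S"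
  using assms by (intro permutes_compose[OF permutes_swap_id])

interpretation qbg: wf_digraph "quantum_bruhat_graph n" for n
proof
  fix e assume e: "e \<in> arcs (quantum_bruhat_graph n)"
  obtain w i j where [simp]: "e = (w, i, j)" by (cases e)
  show "tail (quantum_bruhat_graph n) e \<in> verts (quantum_bruhat_graph n)"
    using e by simp
  show "head (quantum_bruhat_graph n) e \<in> verts (quantum_bruhat_graph n)"
    using e by (auto intro!: permutes_comp_transpose)
qed

text \<open>The exponent of \<open>qvar k\<close> in the weight of the edge. The negated
  \<open>is_up_edge\<close> mirrors the case distinction of \<open>edge_weight\<close>.\<close>

definition edge_exponent :: "nat \<Rightarrow> qedge \<Rightarrow> nat \<Rightarrow> nat" where
  "edge_exponent n = (\<lambda>(w, i, j) k. of_bool (\<not> is_up_edge n (w, i, j) \<and> i \<le> k \<and> k < j))"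

definition walk_exponent :: "nat \<Rightarrow> qedge list \<Rightarrow> nat \<Rightarrow> nat" where
  "walk_exponent n p k = (\<Sum>e\<leftarrow>p. edge_exponent n e k)"

lemma walk_exponent_simps [simp]:
  "walk_exponent n [] k = 0"
  "walk_exponent n (e # p) k = edge_exponent n e k + walk_exponent n p k"
  by (simp_all add: walk_exponent_def)

lemma edge_weight_eq:
  assumes "e \<in> arcs (quantum_bruhat_graph n)"
  shows "edge_weight n e = (\<Prod>k\<in>{1..n - 1}. qvar k ^ edge_exponent n e k)"
proof -
  obtain w i j where e: "e = (w, i, j)" by (cases e)
  have "(\<Prod>k\<in>{i..<j}. qvar k) = (\<Prod>k\<in>{1..n - 1}. if i \<le> k \<and> k < j then qvar k else 1)"
    using assms by (subst prod.inter_filter[symmetric]) (auto simp: e intro!: prod.cong)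
  also have "\<dots> = (\<Prod>k\<in>{1..n - 1}. qvar k ^ of_bool (i \<le> k \<and> k < j))"
    by (intro prod.cong) auto
  finally show ?thesis
    by (simp add: edge_weight_def edge_exponent_def e)
qed

lemma path_weight_eq:
  assumes "set p \<subseteq> arcs (quantum_bruhat_graph n)"
  shows "path_weight n p = (\<Prod>k\<in>{1..n - 1}. qvar k ^ walk_exponent n p k)"
  using assms
  by (induction p) (simp_all add: path_weight_def edge_weight_eq power_add prod.distrib)

text \<open>The weight has degree 0 on an up edge and \<open>j - i\<close> on a down edge, so both
  defining equations say that the length changes by one minus twice the degree.\<close>

lemma sum_edge_exponent:
  assumes "e \<in> arcs (quantum_bruhat_graph n)"
  shows "int (perm_length n (head (quantum_bruhat_graph n) e)) +
    2 * (\<Sum>k\<in>{1..n - 1}. int (edge_exponent n e k)) = int (perm_length n (tail (quantum_bruhat_graph n) e)) + 1"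
proof -
  obtain w i j where e: "e = (w, i, j)" by (cases e)
  show ?thesis
  proof (cases "is_up_edge n e")
    case True
    then show ?thesis by (simp add: e edge_exponent_def is_up_edge_def)
  next
    case False
    have "{k \<in> {1..n - 1}. i \<le> k \<and> k < j} = {i..<j}"
      using assms by (auto simp: e)
    then have "(\<Sum>k\<in>{1..n - 1}. int (edge_exponent n e k)) = int j - int i"
      using False assms by (simp add: e edge_exponent_def sum_of_bool_eq Int_def)
    then show ?thesis
      using False assms by (simp add: e is_down_edge_def)
  qed
qed

text \<open>Telescoping \<open>sum_edge_exponent\<close>. For fixed end points, a shorter walk is
  thus the same as a weight of smaller degree.\<close>

lemma length_awalk:
  assumes "qbg.awalk n u p v"
  shows "int (length p) = int (perm_length n v) - int (perm_length n u) +
    2 * (\<Sum>k\<in>{1..n - 1}. int (walk_exponent n p k))"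
  using assms
proof (induction p arbitrary: u)
  case Nil
  then show ?case by (simp add: qbg.awalk_Nil_iff)
next
  case (Cons e p)
  then show ?case
    using sum_edge_exponent[of e n] by (auto simp: qbg.awalk_Cons_iff sum.distrib)
qed

text \<open>The rank changes only for \<open>i \<le> k < j\<close>, and by at most 1, which a down
  edge pays for. On an up edge the larger entry moves forward, so the rank cannot grow.\<close>

lemma edge_exponent_ge:
  assumes "e \<in> arcs (quantum_bruhat_graph n)"
  shows "rank (head (quantum_bruhat_graph n) e) k m - rank (tail (quantum_bruhat_graph n) e) k m
    \<le> int (edge_exponent n e k)"
proof -
  obtain w i j where e: "e = (w, i, j)" by (cases e)
  show ?thesis
    using assms transpose_ascent_if_up_edge[of w n i j]
    by (auto simp: e edge_exponent_def rank_transpose)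
qed

lemma walk_exponent_ge:
  assumes "qbg.awalk n u p v"
  shows "rank v k m - rank u k m \<le> int (walk_exponent n p k)"
  using assms
proof (induction p arbitrary: u)
  case Nil
  then show ?case by (simp add: qbg.awalk_Nil_iff)
next
  case (Cons e p)
  then show ?case
    using edge_exponent_ge[of e n k m] by (fastforce simp: qbg.awalk_Cons_iff)
qed

text \<open>The rank differences telescope along the walk for each fixed \<open>m\<close>; the depth
  is their maximum over \<open>m\<close>.\<close>

lemma depth_exponent_le_walk_exponent:
  assumes "qbg.awalk n u p v" "k \<le> n"
  shows "depth_exponent n u v k \<le> walk_exponent n p k"
proof -
  have "u permutes {1..n}" "v permutes {1..n}"
    using assms(1) by (auto dest: qbg.awalk_hd_in_verts qbg.awalk_last_in_verts)
  with assms show ?thesis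
    by (simp add: depth_exponent_le_iff walk_exponent_ge)
qed

section \<open>The greedy edge and its effect on depths\<close>

definition cyclic_interval :: "nat \<Rightarrow> nat \<Rightarrow> nat set" where
  "cyclic_interval a b = (if a < b then {a<..b} else {a<..} \<union> {..b})"

text \<open>The number of upward steps from \<open>a\<close> to \<open>b\<close> modulo
  \<open>n\<close>, used as a termination measure.\<close>

definition cyclic_dist :: "nat \<Rightarrow> nat \<Rightarrow> nat \<Rightarrow> nat" where
  "cyclic_dist n a b = (if a \<le> b then b - a else b + n - a)"

text \<open>At an ascent, no entry between the two positions has a value between \<open>w p\<close>
  and \<open>w j\<close>, so the length grows by 1. At a descent the arc wraps around, and avoiding
  it forces each such entry above \<open>b\<close> and below \<open>w p\<close>, hence strictly
  between \<open>w j\<close> and \<open>w p\<close>; the drop in length is then as large as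
  possible.\<close>

lemma greedy_edge:
  assumes w: "w permutes {1..n}" and pj: "1 \<le> p" "p < j" "j \<le> n"
    and c: "w j \<in> cyclic_interval (w p) b"
    and gap: "\<And>l. p < l \<Longrightarrow> l < j \<Longrightarrow> w l \<notin> cyclic_interval (w p) b"
  shows "(w, p, j) \<in> arcs (quantum_bruhat_graph n)"
    and "edge_exponent n (w, p, j) k = of_bool (w j < w p \<and> p \<le> k \<and> k < j)"
proof -
  have inj: "w x = w y \<longleftrightarrow> x = y" for x y
    using permutes_inj[OF w] by (simp add: inj_eq)
  have up: "is_up_edge n (w, p, j)" if asc: "w p < w j"
  proof -
    have none: "{l. p < l \<and> l < j \<and> w p < w l \<and> w l < w j} = {}"
      using gap c asc by (fastforce simp: cyclic_interval_def split: if_splits)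
    show ?thesis
      using perm_length_transpose_ascent[OF w pj asc] by (simp add: is_up_edge_def none)
  qed
  have down: "is_down_edge n (w, p, j)" if desc: "w j < w p"
  proof -
    have "w j < w l \<and> w l < w p" if "p < l" "l < j" for l
      using gap[OF that] c desc inj[of l p] that by (auto simp: cyclic_interval_def split: if_splits)
    then have all: "{l. p < l \<and> l < j \<and> w j < w l \<and> w l < w p} = {p<..<j}"
      by auto
    show ?thesis
      using perm_length_transpose_descent[OF w pj desc] pj by (simp add: is_down_edge_def all)
  qed
  have ne: "w p \<noteq> w j" using pj by (simp add: inj)
  then show "(w, p, j) \<in> arcs (quantum_bruhat_graph n)"
    using w pj up down by (auto simp: not_less_iff_gr_or_eq neq_iff)
  show "edge_exponent n (w, p, j) k = of_bool (w j < w p \<and> p \<le> k \<and> k < j)"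
    using up transpose_ascent_if_up_edge[OF w pj] ne by (auto simp: edge_exponent_def neq_iff)
qed

lemma rank_0:
  assumes "w permutes {1..n}" "k \<le> n"
  shows "rank w k 0 = 0"
proof -
  have "\<not> w l \<le> 0" if "l \<in> {1..k}" for l
    using permutes_in_image[OF assms(1), of l] that assms(2) by auto
  then show ?thesis unfolding rank_def by (intro sum.neutral) auto
qed

lemma rank_top:
  assumes "w permutes {1..n}" "k \<le> n"
  shows "rank w k n = int k"
proof -
  have "w l \<le> n" if "l \<in> {1..k}" for l
    using permutes_in_image[OF assms(1), of l] that assms(2) by auto
  then have "rank w k n = (\<Sum>l\<in>{1..k}. 1)"
    unfolding rank_def by (intro sum.cong) auto
  then show ?thesis by simp
qed

text \<open>Passing from \<open>x\<close> to \<open>y\<close> adds the entries of \<open>v\<close>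
  in between and subtracts those of \<open>u\<close>. Before position \<open>p\<close> they cancel;
  from \<open>p\<close> on, \<open>u\<close> has none, so the change is nonnegative and counts
  \<open>v p\<close>.\<close>

lemma rank_diff_mono:
  assumes agree: "\<And>l. l < p \<Longrightarrow> u l = v l" and p: "1 \<le> p" "p \<le> k" and "x \<le> y"
    and gap: "\<And>l. p \<le> l \<Longrightarrow> l \<le> k \<Longrightarrow> u l \<notin> {x<..y}"
  shows "rank v k x - rank u k x + of_bool (v p \<in> {x<..y}) \<le> rank v k y - rank u k y"
proof -
  have step: "rank w k y - rank w k x = (\<Sum>l\<in>{1..k}. of_bool (w l \<in> {x<..y}))" for w
    unfolding rank_def sum_subtractf[symmetric] using \<open>x \<le> y\<close> by (intro sum.cong) auto
  have pk: "p \<in> {1..k}" using p by auto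
  have "(\<Sum>l\<in>{1..k} - {p}. of_bool (u l \<in> {x<..y})) \<le> (\<Sum>l\<in>{1..k} - {p}. (of_bool (v l \<in> {x<..y}) :: int))"
  proof (rule sum_mono)
    fix l assume "l \<in> {1..k} - {p}"
    then show "of_bool (u l \<in> {x<..y}) \<le> (of_bool (v l \<in> {x<..y}) :: int)"
      using agree[of l] gap[of l] by (cases "l < p") auto
  qed
  moreover have "of_bool (u p \<in> {x<..y}) = (0 :: int)" using gap[of p] p by simp
  ultimately have "rank u k y - rank u k x + of_bool (v p \<in> {x<..y}) \<le> rank v k y - rank v k x"
    unfolding step sum.remove[OF finite_atLeastAtMost pk] by linarith
  then show ?thesis by simp
qed

text \<open>The reverse of the triangle inequality along a greedy edge. Wherever the swap or the
  exponent would exceed the bound, \<open>rank_diff_mono\<close> provides the missing unit.\<close>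

lemma greedy_step:
  assumes u: "u permutes {1..n}" and v: "v permutes {1..n}"
    and agree: "\<And>l. l < p \<Longrightarrow> u l = v l" and pj: "1 \<le> p" "p < j" "j \<le> n" and ne: "u p \<noteq> v p"
    and c: "u j \<in> cyclic_interval (u p) (v p)"
    and gap: "\<And>l. p < l \<Longrightarrow> l < j \<Longrightarrow> u l \<notin> cyclic_interval (u p) (v p)"
    and k: "k \<le> n"
  shows "depth_exponent n (u \<circ> transpose p j) v k + of_bool (u j < u p \<and> p \<le> k \<and> k < j)
    \<le> depth_exponent n u v k"
proof -
  let ?u = "u \<circ> transpose p j"
  let ?e = "of_bool (u j < u p \<and> p \<le> k \<and> k < j) :: nat"
  define d where "d = depth_exponent n u v k"
  define D where "D x = rank v k x - rank u k x" for x
  have u': "?u permutes {1..n}"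
    using u pj by (intro permutes_comp_transpose) auto
  have D: "D x \<le> int d" if "x \<le> n" for x
    using depth_exponent_le_iff[OF u v k, of d] that by (auto simp: d_def D_def)
  have D0: "D 0 = 0" and Dn: "D n = 0"
    using u v k by (simp_all add: D_def rank_0 rank_top)
  have bounds: "1 \<le> u p" "u p \<le> n" "1 \<le> v p" "v p \<le> n" "1 \<le> u j" "u j \<le> n"
    using permutes_in_image[OF u, of p] permutes_in_image[OF v, of p] permutes_in_image[OF u, of j] pj
    by auto
  \<comment> \<open>The exponent \<open>?e\<close> is added on the left because
    \<open>?e \<le> d\<close> is not yet known and \<open>d - ?e\<close> could be truncated.\<close>
  have main: "rank v k x - rank ?u k x + int ?e \<le> int d" if x: "x \<le> n" for x
  proof (cases "p \<le> k \<and> k < j")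
    case False
    then show ?thesis using D[OF x] pj by (auto simp: rank_transpose D_def)
  next
    case True
    have mono: "D x + of_bool (v p \<in> {x<..y}) \<le> D y"
      if "x \<le> y" "u p \<notin> {x<..y}" "{x<..y} \<subseteq> cyclic_interval (u p) (v p)" for x y
    proof -
      have "u l \<notin> {x<..y}" if "p \<le> l" "l \<le> k" for l
        using gap[of l] \<open>u p \<notin> _\<close> \<open>_ \<subseteq> cyclic_interval _ _\<close> that True by (cases "l = p") auto
      from rank_diff_mono[of p u v k, OF agree _ _ \<open>x \<le> y\<close> this] True pj show ?thesis
        by (simp add: D_def)
    qed
    have D': "rank v k x - rank ?u k x = D x + of_bool (u p \<le> x) - of_bool (u j \<le> x)"
      using True pj by (simp add: rank_transpose D_def)
    show ?thesis
    proof (cases "u p < v p")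
      \<comment> \<open>Here \<open>?e = 0\<close>. The swap adds 1 only for
        \<open>u p \<le> x < u j\<close>, where \<open>x < v p\<close> and \<open>D\<close> still
        has to grow by 1 before \<open>v p\<close>.\<close>
      case asc: True
      then have "u p < u j" "u j \<le> v p" using c by (auto simp: cyclic_interval_def)
      moreover have "D x + 1 \<le> D (v p)" if "u p \<le> x" "x < v p"
      proof -
        have "{x<..v p} \<subseteq> cyclic_interval (u p) (v p)"
          using that asc by (auto simp: cyclic_interval_def)
        then show ?thesis using mono[of x "v p"] that by simp
      qed
      ultimately show ?thesis
        using D' D[OF x] D[OF bounds(4)] by (auto simp: of_bool_def)
    next
      case False
      then have desc: "v p < u p" using ne by simp
      then have c': "u p < u j \<or> u j \<le> v p" using c by (auto simp: cyclic_interval_def)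
      have below: "D x + 1 \<le> D (v p)" if "x < v p" for x
      proof -
        have "{x<..v p} \<subseteq> cyclic_interval (u p) (v p)"
          using desc by (auto simp: cyclic_interval_def)
        then show ?thesis using mono[of x "v p"] that desc by simp
      qed
      \<comment> \<open>Beyond \<open>u p\<close> the arc runs up to \<open>n\<close>, where
        \<open>D\<close> vanishes; this is the point at which the circle is cut.\<close>
      have above: "D x \<le> 0" if "u p \<le> x"
      proof -
        have "{x<..n} \<subseteq> cyclic_interval (u p) (v p)"
          using that desc by (auto simp: cyclic_interval_def)
        then show ?thesis using mono[of x n] that desc x Dn by simp
      qed
      \<comment> \<open>Across the cut, \<open>D\<close> rises from \<open>D 0 = 0\<close> to at
        least 1 at \<open>v p\<close>. This gives the unit needed for
        \<open>u p \<le> x\<close>.\<close>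
      have "1 \<le> int d"
        using below[of 0] D[OF bounds(4)] D0 bounds by linarith
      then show ?thesis
        using D' D[OF x] D[OF bounds(4)] below[of x] above c' desc True by (auto simp: of_bool_def)
    qed
  qed
  \<comment> \<open>At \<open>x = 0\<close> both ranks vanish, so \<open>main\<close> reduces to the
    bound on \<open>?e\<close>.\<close>
  have "int ?e \<le> int d" using main[of 0] rank_0[OF u' k] rank_0[OF v k] by linarith
  then have "?e \<le> d" by (simp only: of_nat_le_iff)
  then have "\<forall>x\<le>n. rank v k x - rank ?u k x \<le> int (d - ?e)"
    using main by (auto simp: of_nat_diff algebra_simps)
  then have "depth_exponent n ?u v k \<le> d - ?e"
    using depth_exponent_le_iff[OF u' v k] by blast
  then show ?thesis using \<open>?e \<le> d\<close> d_def by linarith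
qed

section \<open>Construction of the greedy walk\<close>

lemma ex_minimal_awalk:
  assumes "u permutes {1..n}" "v permutes {1..n}"
  shows "\<exists>es. qbg.awalk n u es v \<and> (\<forall>k\<le>n. walk_exponent n es k \<le> depth_exponent n u v k)"
proof -
  have "\<exists>es. qbg.awalk n u es v \<and> (\<forall>k\<le>n. walk_exponent n es k \<le> depth_exponent n u v k)"
    if "u permutes {1..n}" "1 \<le> p" "p \<le> n + 1" "\<And>l. l < p \<Longrightarrow> u l = v l" for u p
    using that
  \<comment> \<open>Either position \<open>p\<close> is already correct and \<open>p\<close>
    advances, whatever the new distance is, or a greedy edge keeps \<open>p\<close> and brings the
    entry there cyclically closer to \<open>v p\<close>.\<close>
  proof (induction "(n + 1 - p, cyclic_dist n (u p) (v p))" arbitrary: u p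
      rule: wf_induct_rule[OF wf_lex_prod[OF wf_less_than wf_less_than]])
    case (1 u p)
    note u = \<open>u permutes {1..n}\<close>
    show ?case
    proof (cases "p = n + 1")
      case True
      have "u = v"
      proof
        fix l show "u l = v l"
          using 1(5)[of l] True permutes_not_in[OF u, of l] permutes_not_in[OF assms(2), of l]
          by (cases "l \<le> n") auto
      qed
      then show ?thesis
        using u by (auto simp: qbg.awalk_Nil_iff intro!: exI[of _ "[]"])
    next
      case pn: False
      show ?thesis
      proof (cases "u p = v p")
        case True
        show ?thesis
        proof (rule 1(1))
          show "((n + 1 - Suc p, cyclic_dist n (u (Suc p)) (v (Suc p))), n + 1 - p, cyclic_dist n (u p) (v p))
            \<in> less_than <*lex*> less_than"
            using 1(4) pn by auto
          show "u l = v l" if "l < Suc p" for l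
            using that True 1(5) by (auto simp: less_Suc_eq)
        qed (use 1(4) pn u in auto)
      next
        case ne: False
        define P where "P j \<longleftrightarrow> p < j \<and> u j \<in> cyclic_interval (u p) (v p)" for j
        have inj: "u x = u y \<longleftrightarrow> x = y" for x y
          using permutes_inj[OF u] by (simp add: inj_eq)
        have pS: "p \<in> {1..n}" using 1(3,4) pn by auto
        have vp: "v p \<in> {1..n}" using permutes_in_image[OF assms(2), of p] pS by simp
        then obtain j0 where j0: "u j0 = v p" "j0 \<in> {1..n}"
          using permutes_image[OF u] by (metis imageE)
        \<comment> \<open>The value \<open>v p\<close> cannot occur earlier in \<open>u\<close>,
          since there \<open>u\<close> agrees with the injective \<open>v\<close>. So there is a
          candidate for the swap.\<close>
        have "p < j0"
        proof (rule ccontr)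
          assume "\<not> p < j0"
          then consider "j0 = p" | "j0 < p" by linarith
          then show False
          proof cases
            case 2
            then have "v j0 = v p" using 1(5)[of j0] j0 by simp
            then show False using 2 permutes_inj[OF assms(2)] by (auto dest: injD)
          qed (use j0 ne in simp)
        qed
        then have "P j0" using j0 ne by (auto simp: P_def cyclic_interval_def)
        define j where "j = (LEAST j. P j)"
        have "P j" unfolding j_def using \<open>P j0\<close> by (rule LeastI)
        then have pj: "p < j" and c: "u j \<in> cyclic_interval (u p) (v p)"
          by (simp_all add: P_def)
        have "j \<le> j0" unfolding j_def using \<open>P j0\<close> by (rule Least_le)
        then have jn: "j \<le> n" using j0 by simp
        have gap: "u l \<notin> cyclic_interval (u p) (v p)" if "p < l" "l < j" for l
          using not_less_Least[of l P] that by (auto simp: P_def j_def)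
        let ?u = "u \<circ> transpose p j"
        have u': "?u permutes {1..n}"
          using u pS jn pj by (intro permutes_comp_transpose) auto
        have agree: "?u l = v l" if "l < p" for l
          using that pj 1(5)[of l] by (simp add: transpose_def)
        have "u p \<in> {1..n}" "u j \<in> {1..n}"
          using permutes_in_image[OF u] pS pj jn by auto
        then have "cyclic_dist n (?u p) (v p) < cyclic_dist n (u p) (v p)"
          using c ne vp by (auto simp: cyclic_dist_def cyclic_interval_def split: if_splits)
        then obtain es where es: "qbg.awalk n ?u es v"
            "\<forall>k\<le>n. walk_exponent n es k \<le> depth_exponent n ?u v k"
          using 1(1)[of p ?u] u' 1(3,4) agree by auto
        note edge = greedy_edge[OF u 1(3) pj jn c gap]
        have "walk_exponent n ((u, p, j) # es) k \<le> depth_exponent n u v k" if k: "k \<le> n" for k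
          using greedy_step[OF u assms(2) 1(5) 1(3) pj jn ne c gap k] es(2) k
          by (fastforce simp: edge(2))
        moreover have "qbg.awalk n u ((u, p, j) # es) v"
          using es(1) edge(1) by (simp only: qbg.awalk_Cons_iff quantum_bruhat_graph_simps)
        ultimately show ?thesis by blast
      qed
    qed
  qed
  \<comment> \<open>For \<open>p = 1\<close> the agreement hypothesis concerns only position 0,
    which lies outside \<open>{1..n}\<close> and is fixed by both.\<close>
  moreover have "u 0 = v 0"
    using assms by (simp add: permutes_not_in)
  ultimately show ?thesis
    using assms(1) by (metis One_nat_def le_add2 less_Suc0 order_refl)
qed

section \<open>From walks to shortest paths\<close>

lemma (in wf_digraph) ex_apath_length_le:
  assumes "awalk u p v"
  shows "\<exists>q. apath u q v \<and> length q \<le> length p"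
proof (intro exI conjI)
  let ?q = "awalk_to_apath p"
  show ap: "apath u ?q v"
    using assms by (rule apath_awalk_to_apath)
  \<comment> \<open>The arcs of the path are distinct and occur among those of \<open>p\<close>, so
    comparing arc sets bounds the length.\<close>
  then have "distinct ?q"
    by (auto simp: apath_def intro: distinct_tl_verts_imp_distinct distinct_tl)
  then have "length ?q = card (set ?q)" by (simp add: distinct_card)
  also have "\<dots> \<le> card (set p)"
    using awalk_to_apath_subset[OF assms] by (simp add: card_mono)
  also have "\<dots> \<le> length p" by (rule card_length)
  finally show "length ?q \<le> length p" .
qed

theorem theorem3p3:
  fixes n :: nat and u v :: "nat \<Rightarrow> nat"
  assumes "u permutes {1..n}" and "v permutes {1..n}"
  shows "is_min_shortest_weight n u v (\<Prod>k\<in>{1..n - 1}. qvar k ^ depth_exponent n u v k)"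
proof -
  let ?d = "depth_exponent n u v"
  obtain es where es: "qbg.awalk n u es v" "\<forall>k\<le>n. walk_exponent n es k \<le> ?d k"
    using ex_minimal_awalk[OF assms] by blast
  obtain q where q: "qbg.apath n u q v" "length q \<le> length es"
    using qbg.ex_apath_length_le[OF es(1)] by blast
  have qw: "qbg.awalk n u q v" using q(1) by (simp add: qbg.apath_def)
  have ge: "?d k \<le> walk_exponent n p k" if "qbg.awalk n u p v" "k \<in> {1..n - 1}" for p k
    using depth_exponent_le_walk_exponent[OF that(1)] that(2) by auto
  \<comment> \<open>Each exponent of \<open>es\<close> is at most the depth and so at most that of
    any other walk; by \<open>length_awalk\<close> the length grows with their sum.\<close>
  have minimal: "length es \<le> length p" if p: "qbg.awalk n u p v" for p
  proof -
    have "walk_exponent n es k \<le> walk_exponent n p k" if "k \<in> {1..n - 1}" for k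
    proof -
      have "k \<le> n" using that by auto
      then show ?thesis using es(2) ge[OF p that] order_trans by blast
    qed
    then have "(\<Sum>k\<in>{1..n - 1}. int (walk_exponent n es k)) \<le> (\<Sum>k\<in>{1..n - 1}. int (walk_exponent n p k))"
      by (intro sum_mono) simp
    then show ?thesis using length_awalk[OF es(1)] length_awalk[OF p] by linarith
  qed
  have "shortest_path n u q v"
    unfolding shortest_path_def is_arg_min_def
    using q minimal by (auto simp: qbg.apath_def not_less intro: order_trans)
  \<comment> \<open>The path \<open>q\<close> may differ from \<open>es\<close>. Being no longer, it
    has an exponent sum at most the sum of the depths, while each exponent is at least its depth;
    equal sums force equality in every term.\<close>
  moreover have "walk_exponent n q k = ?d k" if "k \<in> {1..n - 1}" for k
  proof -
    have le: "int (?d l) \<le> int (walk_exponent n q l)" if "l \<in> {1..n - 1}" for l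
      using ge[OF qw that] by simp
    have "(\<Sum>l\<in>{1..n - 1}. int (walk_exponent n q l)) \<le> (\<Sum>l\<in>{1..n - 1}. int (walk_exponent n es l))"
      using length_awalk[OF es(1)] length_awalk[OF qw] q(2) by linarith
    also have "\<dots> \<le> (\<Sum>l\<in>{1..n - 1}. int (?d l))"
      using es(2) by (intro sum_mono) auto
    finally have "(\<Sum>l\<in>{1..n - 1}. int (walk_exponent n q l)) \<le> (\<Sum>l\<in>{1..n - 1}. int (?d l))" .
    moreover have "(\<Sum>l\<in>{1..n - 1}. int (?d l)) \<le> (\<Sum>l\<in>{1..n - 1}. int (walk_exponent n q l))"
      by (intro sum_mono le)
    ultimately have "(\<Sum>l\<in>{1..n - 1}. int (?d l)) = (\<Sum>l\<in>{1..n - 1}. int (walk_exponent n q l))"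
      by (rule antisym[rotated])
    from sum_mono_inv[OF this le that] show ?thesis by simp
  qed
  then have "path_weight n q = (\<Prod>k\<in>{1..n - 1}. qvar k ^ ?d k)"
    using qw by (subst path_weight_eq) (auto simp: qbg.awalk_def intro!: prod.cong)
  moreover have "(\<Prod>k\<in>{1..n - 1}. qvar k ^ ?d k) dvd path_weight n p" if "shortest_path n u p v" for p
  proof -
    have p: "qbg.awalk n u p v"
      using that by (simp add: shortest_path_def is_arg_min_def qbg.apath_def)
    then have "path_weight n p = (\<Prod>k\<in>{1..n - 1}. qvar k ^ walk_exponent n p k)"
      by (intro path_weight_eq) (auto simp: qbg.awalk_def)
    then show ?thesis
      using ge[OF p] by (auto intro!: prod_dvd_prod le_imp_power_dvd)
  qed
  ultimately show ?thesis
    unfolding is_min_shortest_weight_def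
    by (intro conjI allI impI CollectI exI[of _ q]) simp_all
qed

end
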